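(* Let $P(t) = \sum_{j=0}^{d} \pi_j t^j$ be a polynomial with complex coefficients, of degree $d \geq 2$, such that $\pi_0 = 0$ and $\pi_1 = \pi_2$. Then for all $k \geq 1$ there exist polynomials $p_k(x) = p_k(x;P)$ in $x$ with degree $\deg p_k = (d-2)k+1$ such that, with $p_0(x) = x$, for every $c \in \mathbb{C}$ the formal series $$u(x) = \sum_{k=0}^{\infty} p_k(x+c;P)\, e^{-kx}$$ is a solution of the ODE $$u''u - (u')^2 = e^{-x}P(u) - 1 .$$ Concretely, upon insertion of the formal series into the ODE, for every $k \geq 0$ the polynomials in $x$ multiplying $e^{-kx}$ on the left-hand side and on the right-hand side coincide.
   Context: The series is purely formal: it is an expression $\sum_{k\ge 0} r_k(x) e^{-kx}$ with $r_k \in \mathbb{C}[x]$, i.e. a formal power series in the symbol $e^{-x}$ with coefficients in $\mathbb{C}[x]$. Sums and products are those of formal power series (with $e^{-kx}e^{-lx} = e^{-(k+l)x}$), and the derivative is taken termwise: $(r_k(x)e^{-kx})' = (r_k'(x) - k r_k(x))e^{-kx}$. $P(u)$ means $\sum_{j=0}^d \pi_j u^j$. The polynomials $p_k$ depend on $P$ but not on $c$. No convergence is asserted. *)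

theory Defs
  imports
    "HOL-Computational_Algebra.Polynomial"
    "HOL-Computational_Algebra.Formal_Power_Series"
    "HOL.Complex"
begin

text \<open>
  A formal series \<open>\<Sum>k. r\<^sub>k(x) e\<^sup>-\<^sup>k\<^sup>x\<close> with \<open>r\<^sub>k \<in> \<complex>[x]\<close> is a formal power
  series over \<^typ>\<open>complex poly\<close>: the power series variable \<^const>\<open>fps_X\<close> is the symbol
  \<open>e\<^sup>-\<^sup>x\<close>, and the \<open>k\<close>-th coefficient is the polynomial \<open>r\<^sub>k\<close>.
\<close>

type_synonym exp_series = "complex poly fps"

text \<open>
  The derivative with respect to \<open>x\<close>, where \<open>e\<^sup>-\<^sup>x\<close> depends on \<open>x\<close>:
  \<open>(r\<^sub>k(x) e\<^sup>-\<^sup>k\<^sup>x)' = (r\<^sub>k'(x) - k r\<^sub>k(x)) e\<^sup>-\<^sup>k\<^sup>x\<close>. This is not \<^const>\<open>fps_deriv\<close>.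
\<close>

definition exp_deriv :: "exp_series \<Rightarrow> exp_series" where
  "exp_deriv u = Abs_fps (\<lambda>k. pderiv (fps_nth u k) - of_nat k * fps_nth u k)"

definition poly_at_series :: "complex poly \<Rightarrow> exp_series \<Rightarrow> exp_series" where
  "poly_at_series P u = (\<Sum>j\<le>degree P. fps_const [:coeff P j:] * u ^ j)"

text \<open>\<open>\<Sum>k. p\<^sub>k(x + c) e\<^sup>-\<^sup>k\<^sup>x\<close>; only the coefficients are shifted, \<open>e\<^sup>-\<^sup>k\<^sup>x\<close> is not.\<close>

definition shifted_series :: "(nat \<Rightarrow> complex poly) \<Rightarrow> complex \<Rightarrow> exp_series" where
  "shifted_series p c = Abs_fps (\<lambda>k. pcompose (p k) [:c, 1:])"

definition solves_ode :: "complex poly \<Rightarrow> exp_series \<Rightarrow> bool" where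
  "solves_ode P u \<longleftrightarrow>
     exp_deriv (exp_deriv u) * u - (exp_deriv u)\<^sup>2 = fps_X * poly_at_series P u - 1"

end

theory Submission
  imports Defs
begin

text \<open>
  Let \<open>R = e\<^sup>-\<^sup>x P(u) - 1 - (u''u - u'\<^sup>2)\<close>. With \<open>D = d/dx - k\<close>, the new coefficient \<open>p\<^sub>k\<close> has to solve
  \<open>x D\<^sup>2 p\<^sub>k - 2 D p\<^sub>k = q\<close>, where \<open>q\<close> is the \<open>k\<close>-th coefficient of \<open>R\<close> for the partial sum
  constructed so far. Over the polynomials this is solvable if and only if \<open>x\<close> divides \<open>D\<^sup>2 q\<close>.
  Because \<open>\<pi>\<^sub>0 = 0\<close> and \<open>\<pi>\<^sub>1 = \<pi>\<^sub>2\<close>, the combination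
  \<open>(u' + 1) u' R'' - (u' + 1) u'' R' - 2 \<pi>\<^sub>1 e\<^sup>-\<^sup>x u'\<^sup>2 R\<close> is a multiple of \<open>u\<close>. Its \<open>k\<close>-th coefficient
  is \<open>2 D\<^sup>2 q\<close>, that of the multiple of \<open>u\<close> is a multiple of \<open>p\<^sub>0 = x\<close>, so the condition holds
  automatically.

  For the degrees let \<open>m = d - 2\<close>. The coefficients of \<open>x\<^sup>m\<^sup>k\<^sup>+\<^sup>1\<close> in \<open>p\<^sub>k\<close> form a power series \<open>U(z)\<close> with
  \<open>U(0) = 1\<close> and \<open>\<theta>\<^sup>2U U - (\<theta>U)\<^sup>2 = \<pi>\<^sub>d z U\<^sup>d\<close>, \<open>\<theta> = z d/dz\<close>. Its unique solution is
  \<open>(1 - m \<pi>\<^sub>d z / 2)\<^sup>-\<^sup>2\<^sup>/\<^sup>m\<close> (or \<open>exp (\<pi>\<^sub>d z)\<close> if \<open>m = 0\<close>), which has no vanishing coefficient.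
\<close>

section \<open>The derivation\<close>

lemma exp_deriv_nth [simp]:
  "fps_nth (exp_deriv u) k = pderiv (fps_nth u k) - of_nat k * fps_nth u k"
  by (simp add: exp_deriv_def)

lemma exp_deriv_add: "exp_deriv (f + g) = exp_deriv f + exp_deriv g"
  by (rule fps_ext) (simp add: pderiv_add algebra_simps)

lemma exp_deriv_diff: "exp_deriv (f - g) = exp_deriv f - exp_deriv g"
  by (rule fps_ext) (simp add: pderiv_diff algebra_simps)

lemma exp_deriv_mult: "exp_deriv (f * g) = exp_deriv f * g + f * exp_deriv g"
proof (rule fps_ext)
  fix n
  have "fps_nth (exp_deriv (f * g)) n =
      (\<Sum>i=0..n. pderiv (fps_nth f i * fps_nth g (n - i)) - of_nat n * (fps_nth f i * fps_nth g (n - i)))"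
    by (simp add: fps_mult_nth higher_pderiv_sum[of 1, simplified] sum_subtractf sum_distrib_left)
  also have "\<dots> = (\<Sum>i=0..n. fps_nth (exp_deriv f) i * fps_nth g (n - i)
      + fps_nth f i * fps_nth (exp_deriv g) (n - i))"
  proof (rule sum.cong)
    fix i assume "i \<in> {0..n}"
    then have "(of_nat n :: complex poly) = of_nat i + of_nat (n - i)"
      by (simp flip: of_nat_add)
    then show "pderiv (fps_nth f i * fps_nth g (n - i)) - of_nat n * (fps_nth f i * fps_nth g (n - i))
        = fps_nth (exp_deriv f) i * fps_nth g (n - i) + fps_nth f i * fps_nth (exp_deriv g) (n - i)"
      by (simp add: pderiv_mult algebra_simps)
  qed simp
  finally show "fps_nth (exp_deriv (f * g)) n = fps_nth (exp_deriv f * g + f * exp_deriv g) n"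
    by (simp add: fps_mult_nth sum.distrib)
qed

lemma exp_deriv_const [simp]: "exp_deriv (fps_const [:a:]) = 0"
  by (rule fps_ext) (simp add: pderiv_pCons)

lemma exp_deriv_1 [simp]: "exp_deriv 1 = 0"
  by (rule fps_ext) simp

lemma exp_deriv_numeral [simp]: "exp_deriv (numeral n) = 0"
  by (rule fps_ext) (simp add: fps_numeral_nth)

lemma exp_deriv_X [simp]: "exp_deriv fps_X = - fps_X"
  by (rule fps_ext) simp

section \<open>Lowest-order coefficients of products, and inversion of
  \<open>d/dx - k\<close>\<close>

lemma fps_mult_nth_lowest:
  fixes f g :: "'a::comm_ring_1 fps"
  assumes "\<And>i. i < n \<Longrightarrow> fps_nth g i = 0"
  shows "fps_nth (f * g) n = fps_nth f 0 * fps_nth g n"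
proof -
  have "fps_nth (f * g) n = (\<Sum>i=0..n. if i = 0 then fps_nth f 0 * fps_nth g n else 0)"
    unfolding fps_mult_nth by (rule sum.cong) (auto simp: assms)
  then show ?thesis by simp
qed

lemma fps_mult_nth_below:
  fixes f g :: "'a::comm_ring_1 fps"
  assumes "\<And>i. i < n \<Longrightarrow> fps_nth g i = 0" and "i < n"
  shows "fps_nth (f * g) i = 0"
  using assms by (subst fps_mult_nth_lowest) auto

text \<open>Since \<open>pderiv\<close> lowers the degree, only \<open>- c\<close> acts on the top
  coefficient. Cancelling one top term at a time never raises the degree bound.\<close>

lemma pderiv_minus_smult_solvable:
  fixes w :: "complex poly"
  assumes "c \<noteq> 0" "degree w \<le> n"
  shows "\<exists>p. pderiv p - [:c:] * p = w \<and> degree p \<le> n"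
  using assms(2)
proof (induction n arbitrary: w)
  case 0
  then obtain a where "w = [:a:]" by (metis degree_0_id le_zero_eq)
  then show ?case using assms(1)
    by (intro exI[of _ "[:- a / c:]"]) (simp add: pderiv_pCons)
next
  case (Suc n)
  define a where "a = - coeff w (Suc n) / c"
  define t where "t = monom a (Suc n)"
  have "degree (w - (pderiv t - [:c:] * t)) \<le> n"
  proof (rule degree_le, intro allI impI)
    fix i assume "n < i"
    then consider "i = Suc n" | "i > Suc n" by linarith
    then show "coeff (w - (pderiv t - [:c:] * t)) i = 0"
      using Suc.prems assms(1)
      by cases (auto simp: t_def a_def pderiv_monom coeff_eq_0)
  qed
  from Suc.IH[OF this] obtain p where
    p: "pderiv p - [:c:] * p = w - (pderiv t - [:c:] * t)" "degree p \<le> n" by blast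
  have "degree t \<le> Suc n" unfolding t_def by (rule degree_monom_le)
  with p(2) have "degree (p + t) \<le> Suc n" by (intro degree_add_le) auto
  moreover have "pderiv (p + t) - [:c:] * (p + t) = w"
    using p(1) by (simp add: pderiv_add algebra_simps smult_add_right)
  ultimately show ?case by blast
qed

lemma pderiv_eq_smult_imp_0:
  fixes p :: "complex poly"
  assumes "c \<noteq> 0" "pderiv p = [:c:] * p"
  shows "p = 0"
proof (rule ccontr)
  assume "p \<noteq> 0"
  have "coeff (pderiv p) (degree p) = 0" by (simp add: coeff_pderiv coeff_eq_0)
  with assms \<open>p \<noteq> 0\<close> show False by simp
qed

text \<open>This is \<open>d/dx\<close> conjugated by \<open>e^(-kx)\<close>. For
  \<open>k > 0\<close> it is bijective on polynomials and respects degree bounds; for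
  \<open>k = 0\<close> it kills the constants.\<close>

definition twist :: "nat \<Rightarrow> complex poly \<Rightarrow> complex poly" where
  "twist k p = pderiv p - of_nat k * p"

lemma exp_deriv_nth_twist: "fps_nth (exp_deriv u) k = twist k (fps_nth u k)"
  by (simp add: twist_def)

lemma twist_altdef: "twist k p = pderiv p - [:of_nat k:] * p"
  by (simp add: twist_def of_nat_poly)

lemma twist_solvable:
  assumes "k > 0" "degree w \<le> n"
  obtains p where "twist k p = w" "degree p \<le> n"
  using pderiv_minus_smult_solvable[of "of_nat k" w n] assms unfolding twist_altdef by auto

lemma twist_diff: "twist k (p - q) = twist k p - twist k q"
  by (simp add: twist_def pderiv_diff algebra_simps)

lemma twist_inj:
  assumes "k > 0" "twist k p = twist k q"
  shows "p = q"
proof -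
  have "twist k (p - q) = 0" using assms by (simp add: twist_diff)
  then show ?thesis using pderiv_eq_smult_imp_0[of "of_nat k" "p - q"] assms(1)
    by (simp add: twist_altdef)
qed

text \<open>
  Since \<open>D\<^sup>2(x D s - 2 s) = x D\<^sup>3 s\<close> for \<open>D = twist k\<close>, the equation becomes
  \<open>D\<^sup>4 p = w\<close>.
\<close>

lemma linearized_solvable:
  assumes "k > 0" "twist k (twist k q) = [:0, 1:] * w" "degree w \<le> n"
  obtains p where "[:0, 1:] * twist k (twist k p) - 2 * twist k p = q" "degree p \<le> n"
\<comment> \<open>With \<open>D = twist k\<close>, the polynomials found here are
  \<open>p3 = D^3 p\<close>, \<open>p2 = D^2 p\<close> and \<open>s = D p\<close>.\<close>
proof -
  obtain p3 where p3: "twist k p3 = w" "degree p3 \<le> n" using twist_solvable assms(1,3) by blast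
  obtain p2 where p2: "twist k p2 = p3" "degree p2 \<le> n" using twist_solvable assms(1) p3(2) by blast
  obtain s where s: "twist k s = p2" "degree s \<le> n" using twist_solvable assms(1) p2(2) by blast
  obtain p where p: "twist k p = s" "degree p \<le> n" using twist_solvable assms(1) s(2) by blast
  have X: "twist k ([:0, 1:] * f) = [:0, 1:] * twist k f + f" for f
    unfolding twist_def by (simp add: pderiv_pCons pderiv_mult algebra_simps)
  have A: "twist k (f + g) = twist k f + twist k g" for f g
    by (simp add: twist_def pderiv_add algebra_simps)
  have "twist k (twist k ([:0, 1:] * twist k s - 2 * s)) = [:0, 1:] * w"
    unfolding mult_2 twist_diff A X p2(1) p3(1) s(1) by simp
  with assms(1,2) have "[:0, 1:] * twist k s - 2 * s = q" by (metis twist_inj)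
  with p that show thesis by blast
qed

section \<open>Shifting the coefficients\<close>

definition shift_series :: "complex \<Rightarrow> exp_series \<Rightarrow> exp_series" where
  "shift_series c u = Abs_fps (\<lambda>k. pcompose (fps_nth u k) [:c, 1:])"

lemma shift_series_nth [simp]: "fps_nth (shift_series c u) k = pcompose (fps_nth u k) [:c, 1:]"
  by (simp add: shift_series_def)

lemma shift_series_add: "shift_series c (f + g) = shift_series c f + shift_series c g"
  by (rule fps_ext) (simp add: pcompose_add)

lemma shift_series_diff: "shift_series c (f - g) = shift_series c f - shift_series c g"
  by (rule fps_ext) (simp add: pcompose_diff)

lemma shift_series_mult: "shift_series c (f * g) = shift_series c f * shift_series c g"
  by (rule fps_ext) (simp add: fps_mult_nth pcompose_sum pcompose_mult)

lemma shift_series_const [simp]: "shift_series c (fps_const [:a:]) = fps_const [:a:]"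
  by (rule fps_ext) simp

lemma shift_series_0 [simp]: "shift_series c 0 = 0"
  by (rule fps_ext) simp

lemma shift_series_1 [simp]: "shift_series c 1 = 1"
  by (rule fps_ext) (simp add: pcompose_1)

lemma shift_series_X [simp]: "shift_series c fps_X = fps_X"
  by (rule fps_ext) (simp add: pcompose_1)

lemma shift_series_power: "shift_series c (f ^ n) = shift_series c f ^ n"
  by (induction n) (simp_all add: shift_series_mult)

lemma shift_series_sum: "shift_series c (sum f A) = (\<Sum>i\<in>A. shift_series c (f i))"
  by (induction A rule: infinite_finite_induct) (simp_all add: shift_series_add)

lemma exp_deriv_shift_series: "exp_deriv (shift_series c u) = shift_series c (exp_deriv u)"
  by (rule fps_ext)
    (simp add: pderiv_pcompose pcompose_diff pcompose_mult pcompose_smult pderiv_pCons of_nat_poly)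

text \<open>The equation involves only constants, \<open>e^(-x)\<close> and the derivation. The
  shift is a ring homomorphism that fixes the first two and commutes with the third, so a single
  solution yields those for all \<open>c\<close>.\<close>

lemma solves_ode_shift_series:
  assumes "solves_ode P u"
  shows "solves_ode P (shift_series c u)"
proof -
  have "poly_at_series P (shift_series c u) = shift_series c (poly_at_series P u)"
    by (simp add: poly_at_series_def shift_series_sum shift_series_mult shift_series_power)
  moreover have "shift_series c (exp_deriv (exp_deriv u) * u - (exp_deriv u)\<^sup>2) =
      shift_series c (fps_X * poly_at_series P u - 1)"
    using assms by (simp add: solves_ode_def)
  ultimately show ?thesis
    by (simp add: solves_ode_def exp_deriv_shift_series shift_series_diff shift_series_mult
        shift_series_power)
qed

section \<open>The residual and its compatibility condition\<close>

definition residual :: "complex poly \<Rightarrow> exp_series \<Rightarrow> exp_series" where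
  "residual P u = fps_X * poly_at_series P u - 1 - (exp_deriv (exp_deriv u) * u - (exp_deriv u)\<^sup>2)"

lemma solves_ode_iff_residual: "solves_ode P u \<longleftrightarrow> residual P u = 0"
  by (auto simp: solves_ode_def residual_def)

lemma dvd_poly_at_series_diff: "u - v dvd poly_at_series P u - poly_at_series P v"
proof -
  have "u - v dvd u ^ j - v ^ j" for j
    by (metis dvdI power_diff_sumr2)
  then have "u - v dvd fps_const [:coeff P j:] * (u ^ j - v ^ j)" for j
    by (rule dvd_mult)
  then show ?thesis
    unfolding poly_at_series_def sum_subtractf[symmetric] right_diff_distrib[symmetric]
    by (intro dvd_sum) auto
qed

text \<open>Linearization at the lowest order \<open>n\<close> where \<open>u\<close> and
  \<open>v\<close> may differ. For \<open>q = 0\<close> it shows that the \<open>n\<close>-th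
  residual coefficient depends only on the coefficients up to \<open>n\<close>.\<close>

lemma residual_diff_nth:
  fixes u v :: exp_series
  assumes "\<And>i. i < n \<Longrightarrow> fps_nth u i = fps_nth v i"
    and "fps_nth u 0 = [:0, 1:]" "fps_nth v 0 = [:0, 1:]"
  defines "q \<equiv> fps_nth u n - fps_nth v n"
  shows "fps_nth (residual P u) n = fps_nth (residual P v) n
           - ([:0, 1:] * twist n (twist n q) - 2 * twist n q)"
proof -
  define h where "h = u - v"
  have u: "u = v + h" by (simp add: h_def)
  obtain K where K: "poly_at_series P u - poly_at_series P v = h * K"
    using dvd_poly_at_series_diff[of u v P] unfolding h_def by (elim dvdE)
  have h0: "fps_nth h i = 0" if "i < n" for i using that assms(1) by (simp add: h_def)
  have dh0: "fps_nth (exp_deriv h) i = 0" if "i < n" for i using h0[OF that] by simp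
  have ddh0: "fps_nth (exp_deriv (exp_deriv h)) i = 0" if "i < n" for i using h0[OF that] by simp
  have hn: "fps_nth h n = q" by (simp add: h_def q_def)
  have "residual P u - residual P v = (fps_X * K) * h
      - (u * exp_deriv (exp_deriv h) + exp_deriv (exp_deriv v) * h)
      + (exp_deriv u + exp_deriv v) * exp_deriv h"
  proof -
    have "residual P u - residual P v = fps_X * (poly_at_series P u - poly_at_series P v)
      - (exp_deriv (exp_deriv u) * u - (exp_deriv u)\<^sup>2)
      + (exp_deriv (exp_deriv v) * v - (exp_deriv v)\<^sup>2)"
      by (simp add: residual_def algebra_simps)
    then show ?thesis unfolding K unfolding u exp_deriv_add
      by (simp add: algebra_simps power2_eq_square)
  qed
  then have "fps_nth (residual P u - residual P v) n = fps_nth ((fps_X * K) * h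
      - (u * exp_deriv (exp_deriv h) + exp_deriv (exp_deriv v) * h)
      + (exp_deriv u + exp_deriv v) * exp_deriv h) n" by simp
  \<comment> \<open>Only constant coefficients of the cofactors matter: 0 for
    \<open>fps_X * K\<close>, \<open>x\<close> for \<open>u\<close>, 0 for \<open>v''\<close>, and 1
    for each of \<open>u'\<close> and \<open>v'\<close>.\<close>
  also have "\<dots> = - ([:0, 1:] * twist n (twist n q) - 2 * twist n q)"
    by (simp only: fps_add_nth fps_sub_nth fps_mult_nth_lowest[OF h0]
        fps_mult_nth_lowest[OF dh0] fps_mult_nth_lowest[OF ddh0] exp_deriv_nth_twist hn assms(2,3))
      (simp add: twist_def pderiv_pCons pderiv_1 numeral_poly algebra_simps)
  finally show ?thesis by (simp add: algebra_simps)
qed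

text \<open>The cubic remainder is still divisible by \<open>u\<close> after two derivations, so it
  is invisible in relations modulo \<open>u\<close>.\<close>

lemma poly_at_series_cubic_remainder:
  assumes "degree P \<ge> 2" "coeff P 0 = 0"
  obtains s where "poly_at_series P u =
    fps_const [:coeff P 1:] * u + fps_const [:coeff P 2:] * u\<^sup>2 + u ^ 3 * s"
proof -
  define g where "g = (\<lambda>j. fps_const [:coeff P j:] * u ^ j)"
  have "{..degree P} = {0, 1, 2} \<union> {3..degree P}" using assms(1) by auto
  then have "poly_at_series P u = sum g ({0, 1, 2} \<union> {3..degree P})"
    by (simp add: poly_at_series_def g_def)
  also have "\<dots> = sum g {0, 1, 2} + sum g {3..degree P}"
    by (rule sum.union_disjoint) auto
  also have "sum g {3..degree P} = (\<Sum>j\<in>{3..degree P}. u ^ 3 * (fps_const [:coeff P j:] * u ^ (j - 3)))"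
  proof (rule sum.cong)
    fix j assume "j \<in> {3..degree P}"
    then have "u ^ j = u ^ 3 * u ^ (j - 3)" by (simp flip: power_add)
    then show "g j = u ^ 3 * (fps_const [:coeff P j:] * u ^ (j - 3))"
      by (simp add: g_def mult_ac)
  qed simp
  also have "\<dots> = u ^ 3 * (\<Sum>j\<in>{3..degree P}. fps_const [:coeff P j:] * u ^ (j - 3))"
    by (simp add: sum_distrib_left)
  also have "sum g {0, 1, 2} = fps_const [:coeff P 1:] * u + fps_const [:coeff P 2:] * u\<^sup>2"
    using assms(2) by (simp add: g_def)
  finally show thesis by (rule that)
qed

text \<open>
  Modulo \<open>u\<close>, the residual and its first two derivatives depend only on \<open>u'\<close>, \<open>u''\<close> and
  \<open>e\<^sup>-\<^sup>x\<close>; eliminating gives one relation between them.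
\<close>

lemma residual_identity:
  fixes P :: "complex poly" and u :: exp_series
  assumes "degree P \<ge> 2" "coeff P 0 = 0" "coeff P 1 = coeff P 2"
  defines "R \<equiv> residual P u"
  obtains W where
    "(exp_deriv u + 1) * exp_deriv u * exp_deriv (exp_deriv R)
      - (exp_deriv u + 1) * exp_deriv (exp_deriv u) * exp_deriv R
      - fps_X * (2 * fps_const [:coeff P 1:] * (exp_deriv u)\<^sup>2) * R = u * W"
proof -
  define a :: exp_series where "a = fps_const [:coeff P 1:]"
  have Da: "exp_deriv a = 0" by (simp add: a_def)
  obtain s where s: "poly_at_series P u = a * u + a * u\<^sup>2 + u ^ 3 * s"
    using poly_at_series_cubic_remainder[OF assms(1,2)] assms(3) unfolding a_def by metis
  define v where "v = exp_deriv u"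
  define w where "w = exp_deriv v"
  define w' where "w' = exp_deriv w"
  define s' where "s' = exp_deriv s"
  \<comment> \<open>Chosen so that the derivative of \<open>u ^ 3 * s\<close> is
    \<open>u\<^sup>2 * t\<close>.\<close>
  define t where "t = 3 * v * s + u * s'"
  define t' where "t' = exp_deriv t"
  define z :: exp_series where "z = fps_X"
  have Dz: "exp_deriv z = - z" by (simp add: z_def)
  note D = exp_deriv_add exp_deriv_diff exp_deriv_mult Da Dz exp_deriv_1
  define f where "f = a * u + a * u\<^sup>2 + u ^ 3 * s"
  have f': "exp_deriv f = a * v + 2 * a * u * v + u\<^sup>2 * t"
    by (simp add: f_def D t_def power2_eq_square power3_eq_cube algebra_simps
        flip: v_def s'_def)
  have two: "2 * a * u * v = a * u * v + a * u * v" by simp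
  have f'': "exp_deriv (exp_deriv f) = a * w + 2 * a * v\<^sup>2 + u * (2 * a * w + 2 * v * t + u * t')"
    unfolding f' two
    by (simp add: D power2_eq_square algebra_simps flip: v_def w_def t'_def)
  have R: "R = z * f - 1 - (w * u - v * v)"
    by (simp add: R_def residual_def s f_def z_def w_def v_def power2_eq_square)
  have R': "exp_deriv R = z * exp_deriv f - z * f - (w' * u - w * v)"
    unfolding R by (simp add: D algebra_simps flip: v_def w_def w'_def)
  have R'': "exp_deriv (exp_deriv R) = z * exp_deriv (exp_deriv f) - z * exp_deriv f - z * exp_deriv f
      + z * f - (exp_deriv w' * u - w * w)"
    unfolding R' by (simp add: D algebra_simps flip: v_def w_def w'_def)
  \<comment> \<open>The cofactors of \<open>u\<close> in \<open>R\<close>, \<open>R'\<close> and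
    \<open>R''\<close>.\<close>
  define r0 where "r0 = z * (a + a * u + u\<^sup>2 * s) - w"
  define r1 where "r1 = z * (2 * a * v + u * t) - z * (a + a * u + u\<^sup>2 * s) - w'"
  define r2 where "r2 = z * (2 * a * w + 2 * v * t + u * t') - 2 * z * (2 * a * v + u * t)
    + z * (a + a * u + u\<^sup>2 * s) - exp_deriv w'"
  have 0: "R = v * v - 1 + u * r0"
    by (simp add: R f_def r0_def algebra_simps power2_eq_square power3_eq_cube)
  have 1: "exp_deriv R = z * a * v + w * v + u * r1"
    unfolding R' f' by (simp add: f_def r1_def algebra_simps power2_eq_square power3_eq_cube)
  have 2: "exp_deriv (exp_deriv R) =
      z * (a * w + 2 * a * (v * v)) - 2 * (z * a * v) + w * w + u * r2"
    unfolding R'' f'' unfolding f'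
    by (simp add: f_def r2_def algebra_simps power2_eq_square power3_eq_cube)
  \<comment> \<open>Modulo \<open>u\<close> the first two terms leave
    \<open>(v + 1) * (2 z a v^3 - 2 z a v^2)\<close>. The cubic term comes from the quadratic
    coefficient of \<open>P\<close>, the other from the linear one; as these agree,
    \<open>v^2 - 1\<close> splits off, which is \<open>R\<close> modulo \<open>u\<close>.\<close>
  have "(v + 1) * v * exp_deriv (exp_deriv R) - (v + 1) * w * exp_deriv R - z * (2 * a * v\<^sup>2) * R
      = u * ((v + 1) * v * r2 - (v + 1) * w * r1 - z * (2 * a * v\<^sup>2) * r0)"
    unfolding 2 unfolding 1 unfolding 0 by (simp add: algebra_simps power2_eq_square)
  then show thesis unfolding v_def w_def z_def a_def by (rule that)
qed

lemma residual_compatibility: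
  assumes P: "degree P \<ge> 2" "coeff P 0 = 0" "coeff P 1 = coeff P 2"
    and u0: "fps_nth u 0 = [:0, 1:]"
    and R0: "\<And>i. i < k \<Longrightarrow> fps_nth (residual P u) i = 0"
  obtains w where "twist k (twist k (fps_nth (residual P u) k)) = [:0, 1:] * w"
proof -
  define R where "R = residual P u"
  obtain W where W: "(exp_deriv u + 1) * exp_deriv u * exp_deriv (exp_deriv R)
      - (exp_deriv u + 1) * exp_deriv (exp_deriv u) * exp_deriv R
      - fps_X * (2 * fps_const [:coeff P 1:] * (exp_deriv u)\<^sup>2) * R = u * W" (is "?E = _")
    using residual_identity[OF P] unfolding R_def by metis
  have r: "fps_nth R i = 0" if "i < k" for i using R0 that by (simp add: R_def)
  have r': "fps_nth (exp_deriv R) i = 0" if "i < k" for i using r that by simp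
  have r'': "fps_nth (exp_deriv (exp_deriv R)) i = 0" if "i < k" for i using r that by simp
  have "fps_nth ?E i = 0" if "i < k" for i
    by (simp only: fps_sub_nth fps_mult_nth_below[OF r that] fps_mult_nth_below[OF r' that]
        fps_mult_nth_below[OF r'' that]) simp
  then have uW: "fps_nth (u * W) i = 0" if "i < k" for i using W that by metis
  \<comment> \<open>The constant coefficient \<open>x\<close> of \<open>u\<close> is not a zero
    divisor, so the vanishing passes from \<open>u * W\<close> to \<open>W\<close>.\<close>
  have W0: "fps_nth W i = 0" if "i < k" for i
    using that
  proof (induction i rule: less_induct)
    case (less i)
    then have "fps_nth (u * W) i = fps_nth u 0 * fps_nth W i"
      by (intro fps_mult_nth_lowest) auto
    with uW[OF less.prems] show ?case by (simp add: u0)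
  qed
  \<comment> \<open>As \<open>u' = 1\<close> and \<open>u'' = 0\<close> at order 0, the cofactors of
    \<open>R''\<close>, \<open>R'\<close> and \<open>R\<close> have constant coefficients 2, 0 and
    0.\<close>
  have "fps_nth ?E k = 2 * twist k (twist k (fps_nth R k))"
    by (simp only: fps_sub_nth fps_mult_nth_lowest[OF r] fps_mult_nth_lowest[OF r']
        fps_mult_nth_lowest[OF r''] exp_deriv_nth_twist)
      (simp add: u0 twist_def pderiv_pCons pderiv_1 algebra_simps flip: one_pCons)
  moreover have "fps_nth (u * W) k = [:0, 1:] * fps_nth W k"
    using fps_mult_nth_lowest[OF W0] by (simp add: u0)
  ultimately have "2 * twist k (twist k (fps_nth R k)) = [:0, 1:] * fps_nth W k"
    using W by metis
  then have "smult (1/2) (2 * twist k (twist k (fps_nth R k))) = [:0, 1:] * smult (1/2) (fps_nth W k)"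
    by simp
  moreover have "smult (1/2) (2 * f) = f" for f :: "complex poly"
    by (simp add: numeral_poly)
  ultimately show thesis using that unfolding R_def by metis
qed

section \<open>Degrees and top coefficients\<close>

text \<open>A filtration by weight: \<open>x\<close> has weight 1 and \<open>e^(-x)\<close> has
  weight \<open>- m\<close>, so \<open>x^j e^(-kx)\<close> has weight \<open>j - m k\<close>,
  bounded here by \<open>e\<close>.\<close>

definition deg_le :: "nat \<Rightarrow> nat \<Rightarrow> exp_series \<Rightarrow> bool" where
  "deg_le m e f \<longleftrightarrow> (\<forall>k. degree (fps_nth f k) \<le> m * k + e)"

text \<open>The part of weight exactly \<open>e\<close>, recorded as a series in one
  variable.\<close>

definition top_series :: "nat \<Rightarrow> nat \<Rightarrow> exp_series \<Rightarrow> complex fps" where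
  "top_series m e f = Abs_fps (\<lambda>k. coeff (fps_nth f k) (m * k + e))"

lemma top_series_nth [simp]: "fps_nth (top_series m e f) k = coeff (fps_nth f k) (m * k + e)"
  by (simp add: top_series_def)

lemma deg_le_mono: "deg_le m e f \<Longrightarrow> e \<le> e' \<Longrightarrow> deg_le m e' f"
  unfolding deg_le_def by (meson add_left_mono order_trans)

lemma top_series_eq_0: "deg_le m e f \<Longrightarrow> e < e' \<Longrightarrow> top_series m e' f = 0"
  by (rule fps_ext) (auto simp: deg_le_def intro!: coeff_eq_0 intro: le_less_trans)

lemma deg_le_add: "deg_le m e f \<Longrightarrow> deg_le m e g \<Longrightarrow> deg_le m e (f + g)"
  by (simp add: deg_le_def degree_add_le)

lemma deg_le_diff: "deg_le m e f \<Longrightarrow> deg_le m e g \<Longrightarrow> deg_le m e (f - g)"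
  by (simp add: deg_le_def degree_diff_le)

lemma top_series_add: "top_series m e (f + g) = top_series m e f + top_series m e g"
  by (rule fps_ext) simp

lemma top_series_diff: "top_series m e (f - g) = top_series m e f - top_series m e g"
  by (rule fps_ext) simp

lemma deg_le_const: "deg_le m 0 (fps_const [:a:])"
  by (auto simp: deg_le_def)

lemma deg_le_1: "deg_le m 0 1"
  by (auto simp: deg_le_def)

lemma deg_le_sum: "(\<And>i. i \<in> A \<Longrightarrow> deg_le m e (f i)) \<Longrightarrow> deg_le m e (sum f A)"
  by (induction A rule: infinite_finite_induct) (simp_all add: deg_le_add, simp_all add: deg_le_def)

lemma deg_le_mult_aux:
  assumes "deg_le m e f" "deg_le m e' g" "i \<le> n"
  shows "degree (fps_nth f i) \<le> m * i + e" "degree (fps_nth g (n - i)) \<le> m * (n - i) + e'"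
    and "(m * i + e) + (m * (n - i) + e') = m * n + (e + e')"
proof -
  have "m * i + m * (n - i) = m * n" using assms(3) by (simp flip: add_mult_distrib2)
  then show "(m * i + e) + (m * (n - i) + e') = m * n + (e + e')" by simp
qed (use assms in \<open>auto simp: deg_le_def\<close>)

lemma deg_le_mult:
  assumes "deg_le m e f" "deg_le m e' g"
  shows "deg_le m (e + e') (f * g)"
  unfolding deg_le_def fps_mult_nth
proof (intro allI degree_sum_le)
  fix n i :: nat assume "i \<in> {0..n}"
  then show "degree (fps_nth f i * fps_nth g (n - i)) \<le> m * n + (e + e')"
    using deg_le_mult_aux[OF assms, of i n] degree_mult_le[of "fps_nth f i" "fps_nth g (n - i)"]
    by simp
qed simp

lemma coeff_mult_add_degree_le:
  assumes "degree p \<le> a" "degree q \<le> b"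
  shows "coeff (p * q) (a + b) = coeff p a * coeff q b"
proof -
  have "coeff (p * q) (a + b) = (\<Sum>i\<le>a + b. if i = a then coeff p a * coeff q b else 0)"
    unfolding coeff_mult
  proof (rule sum.cong)
    fix i assume "i \<in> {..a + b}"
    then consider "i = a" | "i > a" | "a + b - i > b" by fastforce
    then show "coeff p i * coeff q (a + b - i) = (if i = a then coeff p a * coeff q b else 0)"
      using assms by cases (auto simp: coeff_eq_0)
  qed simp
  then show ?thesis by simp
qed

text \<open>Weights add under multiplication, so the part of maximal weight in a product comes from
  the maximal parts of both factors alone.\<close>

lemma top_series_mult:
  assumes "deg_le m e f" "deg_le m e' g"
  shows "top_series m (e + e') (f * g) = top_series m e f * top_series m e' g"
proof (rule fps_ext)
  fix n
  have "coeff (fps_nth f i * fps_nth g (n - i)) (m * n + (e + e')) =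
      coeff (fps_nth f i) (m * i + e) * coeff (fps_nth g (n - i)) (m * (n - i) + e')"
    if "i \<in> {0..n}" for i
    using deg_le_mult_aux[OF assms, of i n] that by (metis atLeastAtMost_iff coeff_mult_add_degree_le)
  then show "fps_nth (top_series m (e + e') (f * g)) n =
      fps_nth (top_series m e f * top_series m e' g) n"
    by (simp add: fps_mult_nth coeff_sum)
qed

lemma deg_le_power: "deg_le m e f \<Longrightarrow> deg_le m (j * e) (f ^ j)"
  by (induction j) (auto intro: deg_le_1 deg_le_mult)

lemma top_series_1: "top_series m 0 1 = 1"
  by (rule fps_ext) simp

lemma top_series_power: "deg_le m e f \<Longrightarrow> top_series m (j * e) (f ^ j) = top_series m e f ^ j"
  by (induction j) (simp_all add: top_series_mult deg_le_power top_series_1)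

lemma deg_le_exp_deriv:
  assumes "deg_le m e f"
  shows "deg_le m e (exp_deriv f)"
  unfolding deg_le_def
proof
  fix k
  have f: "degree (fps_nth f k) \<le> m * k + e" using assms by (simp add: deg_le_def)
  then have "degree (pderiv (fps_nth f k)) \<le> m * k + e" by (simp add: degree_pderiv)
  moreover have "degree (of_nat k * fps_nth f k) \<le> m * k + e"
    using f degree_mult_le[of "of_nat k" "fps_nth f k"] by simp
  ultimately show "degree (fps_nth (exp_deriv f) k) \<le> m * k + e"
    by (simp add: degree_diff_le)
qed

section \<open>The equation satisfied by the parts of top weight\<close>

definition fps_theta :: "complex fps \<Rightarrow> complex fps" where
  "fps_theta f = fps_X * fps_deriv f"

lemma fps_theta_nth [simp]: "fps_nth (fps_theta f) n = of_nat n * fps_nth f n"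
  by (cases n) (simp_all add: fps_theta_def del: of_nat_Suc)

lemma fps_theta_add: "fps_theta (f + g) = fps_theta f + fps_theta g"
  by (rule fps_ext) (simp add: algebra_simps)

lemma fps_theta_minus: "fps_theta (- f) = - fps_theta f"
  by (rule fps_ext) simp

text \<open>\<open>pderiv\<close> lowers the weight, so only multiplication by \<open>- k\<close>
  survives at the top.\<close>

lemma top_series_exp_deriv:
  assumes "deg_le m e f"
  shows "top_series m e (exp_deriv f) = - fps_theta (top_series m e f)"
proof (rule fps_ext)
  fix n
  have "degree (fps_nth f n) \<le> m * n + e" using assms by (simp add: deg_le_def)
  then have "coeff (pderiv (fps_nth f n)) (m * n + e) = 0"
    by (simp add: coeff_pderiv coeff_eq_0)
  then show "fps_nth (top_series m e (exp_deriv f)) n = fps_nth (- fps_theta (top_series m e f)) n"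
    by (simp add: of_nat_poly)
qed

lemma deg_le_X_mult:
  assumes "deg_le m (m + e) f"
  shows "deg_le m e (fps_X * f)"
  unfolding deg_le_def
proof
  fix k
  show "degree (fps_nth (fps_X * f) k) \<le> m * k + e"
    using assms unfolding deg_le_def by (cases k) (auto simp: algebra_simps)
qed

lemma top_series_X_mult: "top_series m e (fps_X * f) = fps_X * top_series m (m + e) f"
  by (rule fps_ext) (case_tac n; simp add: algebra_simps)

lemma deg_le_poly_at_series:
  assumes "deg_le m 1 u"
  shows "deg_le m (degree P) (poly_at_series P u)"
  unfolding poly_at_series_def
proof (rule deg_le_sum)
  fix j assume j: "j \<in> {..degree P}"
  have "deg_le m (0 + j * 1) (fps_const [:coeff P j:] * u ^ j)"
    by (intro deg_le_mult deg_le_power assms deg_le_const)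
  then show "deg_le m (degree P) (fps_const [:coeff P j:] * u ^ j)"
    using j by (auto elim: deg_le_mono)
qed

text \<open>The power \<open>u ^ j\<close> has weight at most \<open>j\<close>, so only the leading
  term of \<open>P\<close> reaches weight \<open>degree P\<close>.\<close>

lemma top_series_poly_at_series:
  assumes u: "deg_le m 1 u"
  shows "top_series m (degree P) (poly_at_series P u) =
           fps_const (lead_coeff P) * top_series m 1 u ^ degree P"
proof (cases "degree P")
  case 0
  then show ?thesis
    by (intro fps_ext) (simp add: poly_at_series_def)
next
  case (Suc d)
  let ?g = "\<lambda>j::nat. fps_const [:coeff P j:] * u ^ j"
  have g: "deg_le m j (?g j)" for j
  proof -
    have "deg_le m (0 + j * 1) (?g j)" by (intro deg_le_mult deg_le_power u deg_le_const)
    then show ?thesis by simp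
  qed
  have "deg_le m d (\<Sum>j\<le>d. ?g j)"
    by (intro deg_le_sum deg_le_mono[OF g]) auto
  then have "top_series m (Suc d) (\<Sum>j\<le>d. ?g j) = 0"
    by (rule top_series_eq_0) simp
  moreover have "top_series m (Suc d) (?g (Suc d)) =
      fps_const (lead_coeff P) * top_series m 1 u ^ Suc d"
  proof -
    have "top_series m (0 + Suc d * 1) (?g (Suc d)) =
        top_series m 0 (fps_const [:coeff P (Suc d):]) * top_series m (Suc d * 1) (u ^ Suc d)"
      by (intro top_series_mult deg_le_const deg_le_power u)
    moreover have "top_series m 0 (fps_const [:coeff P (Suc d):]) = fps_const (lead_coeff P)"
      by (rule fps_ext) (simp add: Suc)
    ultimately show ?thesis using top_series_power[OF u, of "Suc d"] by simp
  qed
  ultimately show ?thesis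
    by (simp add: poly_at_series_def Suc top_series_add)
qed

text \<open>This fixes the slope \<open>m = d - 2\<close>: \<open>e^(-x) P(u)\<close> has weight at
  most \<open>(m + 2) - m = 2\<close>, the same bound as for \<open>u''u\<close> and
  \<open>u'^2\<close>.\<close>

lemma deg_le_residual:
  assumes "degree P = m + 2" "deg_le m 1 u"
  shows "deg_le m 2 (residual P u)"
proof -
  have D: "deg_le m 1 (exp_deriv u)" "deg_le m 1 (exp_deriv (exp_deriv u))"
    using assms(2) deg_le_exp_deriv by blast+
  have "deg_le m 2 (fps_X * poly_at_series P u)"
    using deg_le_poly_at_series[OF assms(2), of P] assms(1) by (intro deg_le_X_mult) simp
  moreover have "deg_le m 2 1" using deg_le_1 by (rule deg_le_mono) simp
  moreover have "deg_le m 2 (exp_deriv (exp_deriv u) * u)"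
    using deg_le_mult[OF D(2) assms(2)] by (simp add: numeral_2_eq_2)
  moreover have "deg_le m 2 ((exp_deriv u)\<^sup>2)"
    using deg_le_power[OF D(1), of 2] by simp
  ultimately show ?thesis unfolding residual_def by (intro deg_le_diff)
qed

text \<open>The weight 2 part of the equation. The constant 1 has weight 0 and drops out.\<close>

lemma top_series_ode:
  fixes u :: exp_series
  assumes "degree P = m + 2" "deg_le m 1 u" "solves_ode P u"
  defines "U \<equiv> top_series m 1 u"
  shows "fps_theta (fps_theta U) * U - (fps_theta U)\<^sup>2 = fps_const (lead_coeff P) * fps_X * U ^ (m + 2)"
proof -
  have D: "deg_le m 1 (exp_deriv u)" "deg_le m 1 (exp_deriv (exp_deriv u))"
    using assms(2) deg_le_exp_deriv by blast+
  have "top_series m 1 (exp_deriv u) = - fps_theta U"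
    unfolding U_def by (rule top_series_exp_deriv[OF assms(2)])
  moreover from this have "top_series m 1 (exp_deriv (exp_deriv u)) = fps_theta (fps_theta U)"
    using top_series_exp_deriv[OF D(1)] by (simp add: fps_theta_minus)
  ultimately have "top_series m 2 (exp_deriv (exp_deriv u) * u - (exp_deriv u)\<^sup>2) =
      fps_theta (fps_theta U) * U - (fps_theta U)\<^sup>2"
    using top_series_mult[OF D(2) assms(2)] top_series_mult[OF D(1) D(1)]
    by (simp add: top_series_diff power2_eq_square U_def numeral_2_eq_2)
  moreover have "top_series m 2 (fps_X * poly_at_series P u - 1) =
      fps_const (lead_coeff P) * fps_X * U ^ (m + 2)"
  proof -
    have "top_series m 2 1 = 0" using deg_le_1 by (rule top_series_eq_0) simp
    then show ?thesis
      using top_series_poly_at_series[OF assms(2), of P] assms(1)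
      by (simp only: top_series_diff top_series_X_mult U_def) (simp add: mult_ac)
  qed
  ultimately show ?thesis using assms(3) by (simp add: solves_ode_def)
qed

section \<open>The equation of the top coefficients\<close>

text \<open>At the lowest order \<open>n > 0\<close> of \<open>h = U - V\<close>, the factor
  \<open>fps_X\<close> removes the right-hand side and \<open>fps_theta\<close> the other constant
  coefficients, leaving \<open>n^2 h_n = 0\<close>.\<close>

lemma top_ode_unique:
  fixes U V :: "complex fps"
  assumes U: "fps_theta (fps_theta U) * U - (fps_theta U)\<^sup>2 = fps_const a * fps_X * U ^ d"
    and V: "fps_theta (fps_theta V) * V - (fps_theta V)\<^sup>2 = fps_const a * fps_X * V ^ d"
    and 1: "fps_nth U 0 = 1" "fps_nth V 0 = 1"
  shows "U = V"
proof -
  define h where "h = U - V"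
  have Uh: "U = V + h" by (simp add: h_def)
  have "h dvd U ^ d - V ^ d" unfolding h_def by (metis dvdI power_diff_sumr2)
  then obtain K where K: "U ^ d - V ^ d = h * K" by (elim dvdE)
  have "fps_nth h n = 0" for n
  proof (induction n rule: less_induct)
    case (less n)
    show ?case
    proof (cases "n = 0")
      case True
      then show ?thesis using 1 by (simp add: h_def)
    next
      case False
      have h1: "fps_nth (fps_theta h) i = 0" if "i < n" for i
        using less that by simp
      have h2: "fps_nth (fps_theta (fps_theta h)) i = 0" if "i < n" for i
        using less that by simp
      have "(fps_theta (fps_theta U) * U - (fps_theta U)\<^sup>2) - (fps_theta (fps_theta V) * V - (fps_theta V)\<^sup>2)
          = U * fps_theta (fps_theta h) + fps_theta (fps_theta V) * h - (fps_theta U + fps_theta V) * fps_theta h"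
        unfolding Uh by (simp add: fps_theta_add algebra_simps power2_eq_square)
      moreover have "fps_const a * fps_X * U ^ d - fps_const a * fps_X * V ^ d = (fps_const a * fps_X * K) * h"
        using K by (simp flip: right_diff_distrib add: mult_ac)
      ultimately have "fps_nth (U * fps_theta (fps_theta h) + fps_theta (fps_theta V) * h
            - (fps_theta U + fps_theta V) * fps_theta h) n = fps_nth ((fps_const a * fps_X * K) * h) n"
        using U V by metis
      then have "of_nat n * (of_nat n * fps_nth h n) = 0"
        by (simp only: fps_sub_nth fps_add_nth fps_mult_nth_lowest[OF less]
            fps_mult_nth_lowest[OF h1] fps_mult_nth_lowest[OF h2]) (simp add: 1)
      with False show ?thesis by simp
    qed
  qed
  then have "h = 0" by (intro fps_ext) simp
  then show ?thesis by (simp add: h_def)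
qed

text \<open>
  The coefficients of \<open>(1 - c z)\<^sup>-\<^sup>2\<^sup>/\<^sup>m\<close> with \<open>c = m a / 2\<close>, respectively of \<open>exp (a z)\<close> if \<open>m = 0\<close>.
\<close>

definition top_coeff :: "nat \<Rightarrow> complex \<Rightarrow> nat \<Rightarrow> complex" where
  "top_coeff m a k = (\<Prod>i<k. a * (1 + of_nat m * of_nat i / 2) / of_nat (Suc i))"

text \<open>Every factor is \<open>a\<close> times a positive rational number.\<close>

lemma top_coeff_nonzero:
  assumes "a \<noteq> 0"
  shows "top_coeff m a k \<noteq> 0"
proof -
  have "1 + of_nat m * of_nat i / 2 \<noteq> (0 :: complex)" for i
  proof -
    have "1 + of_nat m * of_nat i / 2 = (of_nat (2 + m * i) / 2 :: complex)"
      by (simp add: add_divide_distrib)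
    then show ?thesis by (metis add_is_0 divide_eq_0_iff of_nat_eq_0_iff zero_neq_numeral)
  qed
  then show ?thesis using assms by (simp add: top_coeff_def del: of_nat_Suc)
qed

text \<open>Fractional powers are avoided, and \<open>m = 0\<close> is included: the linear equation
  \<open>(1 - C z) U' = A U\<close> and the first integral \<open>U^m (1 - C z)^2 = 1\<close>
  suffice.\<close>

lemma top_ode_solution:
  fixes m :: nat and a :: complex
  defines "U \<equiv> Abs_fps (top_coeff m a)"
  shows "fps_theta (fps_theta U) * U - (fps_theta U)\<^sup>2 = fps_const a * fps_X * U ^ (m + 2)"
proof -
  define A where "A = fps_const a"
  define C where "C = fps_const (of_nat m * a / 2)"
  define z :: "complex fps" where "z = fps_X"
  have mA: "of_nat m * A = 2 * C"
    by (simp add: A_def C_def numeral_fps_const flip: fps_of_nat)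
  have dA: "fps_deriv A = 0" and dC: "fps_deriv C = 0" and dz: "fps_deriv z = 1"
    by (simp_all add: A_def C_def z_def)
  define V where "V = fps_deriv U"
  have lin: "(1 - C * z) * V = A * U"
  proof (rule fps_ext)
    fix n
    have "of_nat (Suc n) * top_coeff m a (Suc n) = a * (1 + of_nat m * of_nat n / 2) * top_coeff m a n"
      by (simp add: top_coeff_def del: of_nat_Suc)
    moreover have "fps_nth ((1 - C * z) * V) n = fps_nth V n - of_nat m * a / 2 * fps_nth (fps_theta U) n"
      by (simp add: left_diff_distrib C_def z_def V_def fps_theta_def mult.assoc)
    ultimately show "fps_nth ((1 - C * z) * V) n = fps_nth (A * U) n"
      by (simp add: V_def U_def A_def algebra_simps del: of_nat_Suc)
  qed
  then have "fps_deriv ((1 - C * z) * V) = fps_deriv (A * U)" by simp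
  then have lin2: "(1 - C * z) * fps_deriv V = C * V + A * V"
    by (simp add: dA dC dz algebra_simps flip: V_def)
  have nz: "1 - C * z \<noteq> 0"
  proof
    assume "1 - C * z = 0"
    then have "fps_nth (1 - C * z) 0 = 0" by simp
    then show False by (simp add: z_def)
  qed
  have one: "U ^ m * (1 - C * z)\<^sup>2 = 1"
  proof -
    \<comment> \<open>The extra factor \<open>U\<close> turns \<open>U ^ (m - 1)\<close> into
      \<open>U ^ m\<close>; for \<open>m = 0\<close>, where \<open>m - 1\<close> is truncated, the
      factor \<open>of_nat m\<close> vanishes.\<close>
    have "U * fps_deriv (U ^ m * (1 - C * z)\<^sup>2) =
        of_nat m * V * (U * U ^ (m - 1)) * (1 - C * z)\<^sup>2 - 2 * C * (1 - C * z) * (U * U ^ m)"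
      by (simp add: fps_deriv_power fps_of_nat dC dz power2_eq_square algebra_simps flip: V_def)
    also have "of_nat m * V * (U * U ^ (m - 1)) * (1 - C * z)\<^sup>2 =
        of_nat m * U ^ m * (1 - C * z) * ((1 - C * z) * V)"
      by (cases m) (simp_all add: power2_eq_square mult_ac)
    also have "\<dots> = (of_nat m * A) * (1 - C * z) * (U * U ^ m)"
      unfolding lin by (simp add: mult_ac)
    finally have "U * fps_deriv (U ^ m * (1 - C * z)\<^sup>2) = 0" by (simp add: mA)
    moreover have "U \<noteq> 0"
      by (auto simp: U_def fps_eq_iff top_coeff_def intro!: exI[of _ 0])
    ultimately have "fps_deriv (U ^ m * (1 - C * z)\<^sup>2) = 0" by simp
    then obtain c where "U ^ m * (1 - C * z)\<^sup>2 = fps_const c"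
      by (metis fps_deriv_eq_0_iff)
    moreover from this have "c = 1"
      by (auto dest!: arg_cong[of _ _ "\<lambda>f. fps_nth f 0"]
          simp: z_def U_def top_coeff_def power2_eq_square fps_power_zeroth)
    ultimately show ?thesis by simp
  qed
  have "(1 - C * z)\<^sup>2 * (fps_theta (fps_theta U) * U - (fps_theta U)\<^sup>2) =
      z * ((1 - C * z) * ((1 - C * z) * V) + z * ((1 - C * z) * ((1 - C * z) * fps_deriv V))) * U
        - (z * ((1 - C * z) * V))\<^sup>2"
    by (simp add: fps_theta_def power2_eq_square algebra_simps dz flip: V_def z_def)
  \<comment> \<open>After substitution the bracket is
    \<open>1 - C z + (C + A) z - A z = 1\<close>.\<close>
  also have "\<dots> = A * z * U\<^sup>2 * 1"
  proof -
    have "(1 - C * z) * (C * V + A * V) = (C + A) * ((1 - C * z) * V)"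
      by (simp add: algebra_simps)
    then have eq: "(1 - C * z) * (C * V + A * V) = (C + A) * (A * U)"
      unfolding lin .
    show ?thesis unfolding lin lin2 eq
      by (simp add: power2_eq_square algebra_simps)
  qed
  also have "\<dots> = A * z * U\<^sup>2 * (U ^ m * (1 - C * z)\<^sup>2)"
    by (simp only: one)
  also have "\<dots> = (1 - C * z)\<^sup>2 * (A * z * U ^ (m + 2))"
    by (simp only: power_add mult_ac)
  finally show ?thesis using nz by (simp add: A_def z_def)
qed

section \<open>The solution\<close>

lemma ode_solution_exists:
  assumes P: "degree P = m + 2" "coeff P 0 = 0" "coeff P 1 = coeff P 2"
  obtains u where "fps_nth u 0 = [:0, 1:]" "deg_le m 1 u" "solves_ode P u"
proof -
  \<comment> \<open>Approximate solutions through order \<open>n\<close>, with the degree bound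
    carried along.\<close>
  define good where "good = (\<lambda>n u. fps_nth u 0 = [:0, 1:] \<and> deg_le m 1 u \<and>
    (\<forall>i\<le>n. fps_nth (residual P u) i = 0))"
  have base: "good 0 (fps_const [:0, 1:])"
    unfolding good_def
    by (auto simp: deg_le_def residual_def pderiv_pCons power2_eq_square one_pCons)
  have step: "\<exists>v. good (Suc n) v \<and> (\<forall>i\<le>n. fps_nth v i = fps_nth u i)" if u: "good n u" for n u
  proof -
    define q where "q = fps_nth (residual P u) (Suc n)"
    have u0: "fps_nth u 0 = [:0, 1:]" and du: "deg_le m 1 u"
      and R: "\<And>i. i < Suc n \<Longrightarrow> fps_nth (residual P u) i = 0"
      using u by (auto simp: good_def)
    obtain w where w: "twist (Suc n) (twist (Suc n) q) = [:0, 1:] * w"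
      using residual_compatibility[OF _ P(2,3) u0 R] P(1) unfolding q_def by auto
    have "deg_le m 2 (exp_deriv (exp_deriv (residual P u)))"
      by (intro deg_le_exp_deriv deg_le_residual P du)
    then have "degree ([:0, 1:] * w) \<le> m * Suc n + 2"
      using w unfolding deg_le_def exp_deriv_nth_twist q_def by metis
    \<comment> \<open>The residual has offset 2, and dividing by \<open>x\<close> lowers it to the
      offset 1 required of the new coefficient.\<close>
    then have "degree w \<le> m * Suc n + 1"
      by (cases "w = 0") (simp_all add: degree_pCons_eq)
    then obtain p where p: "[:0, 1:] * twist (Suc n) (twist (Suc n) p) - 2 * twist (Suc n) p = q"
      "degree p \<le> m * Suc n + 1" using linearized_solvable[OF _ w] by blast
    \<comment> \<open>Adding \<open>p\<close> at order \<open>n + 1\<close> changes the residual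
      coefficient there by \<open>- q\<close>, which makes it zero.\<close>
    define v where "v = Abs_fps (\<lambda>i. if i = Suc n then fps_nth u i + p else fps_nth u i)"
    have vu: "fps_nth v i = fps_nth u i" if "i < Suc n" for i using that by (simp add: v_def)
    have v0: "fps_nth v 0 = [:0, 1:]" using u0 by (simp add: v_def)
    have "deg_le m 1 v"
      unfolding deg_le_def
    proof
      fix i
      have "degree (fps_nth u i) \<le> m * i + 1" using du by (simp add: deg_le_def)
      with p(2) show "degree (fps_nth v i) \<le> m * i + 1"
        by (auto simp: v_def intro: degree_add_le)
    qed
    moreover have "fps_nth (residual P v) i = 0" if "i \<le> Suc n" for i
    proof (cases "i = Suc n")
      case True
      have "fps_nth v (Suc n) - fps_nth u (Suc n) = p" by (simp add: v_def)
      then show ?thesis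
        using residual_diff_nth[OF vu v0 u0, of "Suc n"] p(1) unfolding True q_def by simp
    next
      case False
      then have "fps_nth (residual P v) i = fps_nth (residual P u) i"
        using residual_diff_nth[OF _ v0 u0, of i] vu that by (simp add: twist_def)
      then show ?thesis using R False that by simp
    qed
    ultimately have "good (Suc n) v" using v0 by (simp add: good_def)
    then show ?thesis using vu by auto
  qed
  obtain us where us: "\<And>n. good n (us n)"
    "\<And>n i. i \<le> n \<Longrightarrow> fps_nth (us (Suc n)) i = fps_nth (us n) i"
    using dependent_nat_choice[of good "\<lambda>n u v. \<forall>i\<le>n. fps_nth v i = fps_nth u i"] base step
    by metis
  have stable: "fps_nth (us n) i = fps_nth (us i) i" if "i \<le> n" for n i
    using that by (induction n rule: dec_induct) (simp_all add: us(2))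
  \<comment> \<open>The diagonal limit: the \<open>i\<close>-th coefficient is constant from the
    \<open>i\<close>-th approximation on.\<close>
  define u where "u = Abs_fps (\<lambda>n. fps_nth (us n) n)"
  have u0: "fps_nth u 0 = [:0, 1:]" using us(1)[of 0] by (simp add: u_def good_def)
  moreover have "deg_le m 1 u"
    using us(1) by (simp add: u_def good_def deg_le_def)
  moreover have "fps_nth (residual P u) n = 0" for n
  proof -
    have "fps_nth (us n) 0 = [:0, 1:]" using us(1) by (simp add: good_def)
    moreover have "fps_nth u i = fps_nth (us n) i" if "i \<le> n" for i
      using stable[OF that] by (simp add: u_def)
    ultimately have "fps_nth (residual P u) n = fps_nth (residual P (us n)) n"
      using residual_diff_nth[of n u "us n" P] u0 by (simp add: twist_def)
    then show ?thesis using us(1) by (simp add: good_def)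
  qed
  then have "solves_ode P u" unfolding solves_ode_iff_residual by (intro fps_ext) simp
  ultimately show thesis using that by blast
qed

theorem theorem2p5:
  fixes P :: "complex poly" and d :: nat
  assumes "degree P = d" and "d \<ge> 2"
    and "coeff P 0 = 0" and "coeff P 1 = coeff P 2"
  shows "\<exists>p :: nat \<Rightarrow> complex poly.
           p 0 = [:0, 1:] \<and>
           (\<forall>k\<ge>1. degree (p k) = (d - 2) * k + 1) \<and>
           (\<forall>c :: complex. solves_ode P (shifted_series p c))"
proof -
  define m where "m = d - 2"
  have deg: "degree P = m + 2" using assms(1,2) by (simp add: m_def)
  obtain u where u: "fps_nth u 0 = [:0, 1:]" "deg_le m 1 u" "solves_ode P u"
    using ode_solution_exists[OF deg assms(3,4)] by blast
  define a where "a = lead_coeff P"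
  have "a \<noteq> 0" using deg unfolding a_def by (metis add_is_0 degree_0 leading_coeff_0_iff zero_neq_numeral)
  \<comment> \<open>Both series start with 1: one because \<open>x\<close> has leading coefficient
    1, the other as an empty product.\<close>
  have top: "top_series m 1 u = Abs_fps (top_coeff m a)"
    using top_series_ode[OF deg u(2,3)] top_ode_solution[of m a]
    unfolding a_def[symmetric]
    by (rule top_ode_unique) (simp_all add: u(1) top_coeff_def)
  have "degree (fps_nth u k) = m * k + 1" for k
  proof (rule antisym)
    show "degree (fps_nth u k) \<le> m * k + 1" using u(2) by (simp add: deg_le_def)
    have "coeff (fps_nth u k) (m * k + 1) = top_coeff m a k"
      using arg_cong[OF top, of "\<lambda>f. fps_nth f k"] by simp
    then show "m * k + 1 \<le> degree (fps_nth u k)"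
      using top_coeff_nonzero[OF \<open>a \<noteq> 0\<close>] by (intro le_degree) simp
  qed
  moreover have "shifted_series (fps_nth u) c = shift_series c u" for c
    by (simp add: shifted_series_def shift_series_def)
  ultimately show ?thesis
    using u(1) solves_ode_shift_series[OF u(3)]
    by (intro exI[of _ "fps_nth u"]) (simp add: m_def)
qed

end
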